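(* Let $\mathcal{G}$ be a finite simple undirected graph whose adjacency matrix has eigenvalues $\lambda_1\ge\dots\ge\lambda_n$ (with multiplicity), so the spectral radius is $\rho=\lambda_1$. Let $\mu=\sum_{i=1}^n\alpha_i\delta_{\lambda_i}$ with $\alpha_i\ge0$ and $\alpha_1>0$, and $m_k=\sum_i\alpha_i\lambda_i^k$. Let $1\le j_1<j_2<\dots<j_s$ be integers, $\mathcal{J}=\{j_1,\dots,j_s\}$, $\mathcal{J}'=\{j_1,\dots,j_{s-1}\}$, and assume $H_{\mathcal{J}'}(\mathbf{m})\succ0$ (vacuous if $s=1$). For $r\in\mathbb{R}$ let $R_{\mathcal{J}}:=(r^{a+b-2})_{a,b\in\mathcal{J}}$ and $$Q(r):=\det\left(H_{\mathcal{J}}(\mathbf{m})-\alpha_1R_{\mathcal{J}}\right).$$ Then $Q$ has a real root, and its largest real root $r^*$ satisfies $\rho\le r^*$.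
   Context: $\delta_a$ is the Dirac measure at $a$. For a finite set $\mathcal{K}$ of positive integers, $H_{\mathcal{K}}(\mathbf{m}):=(m_{a+b-2})_{a,b\in\mathcal{K}}$ is the principal submatrix indexed by $\mathcal{K}$ (1-based) of the Hankel matrix $(m_{a+b-2})_{a,b\ge1}$. $M\succ0$ means positive definite.
   Formalization: The index set J = {1} is excluded: there Q is the constant α_2+…+α_n, which either has no real root (e.g. K_2 with α = (1,1), Q = 1) or is identically zero and has no largest root, so the claim fails for that J. *)

theory Defs
  imports
    "Jordan_Normal_Form.Spectral_Radius"
    "Graph_Theory.Pair_Digraph"
begin

(* The rows and columns are indexed by a list vs that enumerates the vertices without
   repetition; a different enumeration gives a permutation-similar matrix. *)
definition adjacency_mat :: "'a pair_pre_digraph \<Rightarrow> 'a list \<Rightarrow> real mat" where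
  "adjacency_mat G vs =
     mat (length vs) (length vs) (\<lambda>(u, v). if (vs ! u, vs ! v) \<in> parcs G then 1 else 0)"

definition moment :: "nat \<Rightarrow> (nat \<Rightarrow> real) \<Rightarrow> (nat \<Rightarrow> real) \<Rightarrow> nat \<Rightarrow> real" where
  "moment n \<alpha> lam k = (\<Sum>i = 1..n. \<alpha> i * lam i ^ k)"

(* Entries of the infinite Hankel matrix, with 1-based indices a, b: for a, b \<ge> 1 the
   subtraction on nat does not truncate. *)
definition hankel :: "(nat \<Rightarrow> real) \<Rightarrow> nat \<Rightarrow> nat \<Rightarrow> real" where
  "hankel m a b = m (a + b - 2)"

(* Principal submatrix, indexed by the finite set K, of an infinite matrix A. The elements
   of K are taken in increasing order; the resulting matrix type counts rows from 0. *)
definition principal_submat :: "nat set \<Rightarrow> (nat \<Rightarrow> nat \<Rightarrow> 'b) \<Rightarrow> 'b mat" where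
  "principal_submat K A =
     mat (card K) (card K)
       (\<lambda>(p, q). A (sorted_list_of_set K ! p) (sorted_list_of_set K ! q))"

(* The empty (0 by 0) matrix is positive definite. *)
definition positive_definite :: "real mat \<Rightarrow> bool" where
  "positive_definite M \<longleftrightarrow>
     square_mat M \<and> transpose_mat M = M \<and>
     (\<forall>v \<in> carrier_vec (dim_row M). v \<noteq> 0\<^sub>v (dim_row M) \<longrightarrow> 0 < v \<bullet> (M *\<^sub>v v))"

definition H_mat :: "(nat \<Rightarrow> real) \<Rightarrow> nat set \<Rightarrow> real mat" where
  "H_mat m K = principal_submat K (hankel m)"

definition R_mat :: "real \<Rightarrow> nat set \<Rightarrow> real mat" where
  "R_mat r K = principal_submat K (hankel (\<lambda>k. r ^ k))"

(* For K = {1} this is the constant m 0 - c, independent of r. *)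
definition Q_fun :: "(nat \<Rightarrow> real) \<Rightarrow> real \<Rightarrow> nat set \<Rightarrow> real \<Rightarrow> real" where
  "Q_fun m c K r = det (H_mat m K - c \<cdot>\<^sub>m R_mat r K)"

end

theory Submission
  imports Defs
begin

text \<open>The adjacency matrix \<open>A\<close> is nonnegative, so every odd power sum of its eigenvalues, being the
  trace of a power of \<open>A\<close>, is nonnegative. This rules out an eigenvalue below \<open>- lam 1\<close>, so
  \<open>lam 1\<close> is the spectral radius. At \<open>lam 1\<close> the matrix defining \<open>Q\<close> is the sum of the
  positive semidefinite rank-one terms of the remaining eigenvalues, so \<open>Q\<close> is nonnegative there.
  With \<open>d\<close> the largest index minus one, \<open>Q r / r ^ (2 * d)\<close> tends to
  \<open>- \<alpha> 1\<close> times the determinant of the positive definite minor, so \<open>Q\<close> is eventually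
  negative. Hence \<open>Q\<close> has a largest root, and it lies at or beyond \<open>lam 1\<close>.\<close>

section \<open>Traces of powers as power sums of eigenvalues\<close>

definition mat_trace :: "'a :: comm_monoid_add mat \<Rightarrow> 'a" where
  "mat_trace A = (\<Sum>i<dim_row A. A $$ (i, i))"

lemma mat_trace_mult_commute:
  fixes A B :: "'a :: comm_semiring_0 mat"
  assumes "A \<in> carrier_mat n m" "B \<in> carrier_mat m n"
  shows "mat_trace (A * B) = mat_trace (B * A)"
proof -
  have "mat_trace (A * B) = (\<Sum>i<n. \<Sum>k<m. A $$ (i, k) * B $$ (k, i))"
    using assms by (simp add: mat_trace_def scalar_prod_def atLeast0LessThan)
  also have "\<dots> = (\<Sum>k<m. \<Sum>i<n. B $$ (k, i) * A $$ (i, k))"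
    by (subst sum.swap) (simp add: mult.commute)
  also have "\<dots> = mat_trace (B * A)"
    using assms by (simp add: mat_trace_def scalar_prod_def atLeast0LessThan)
  finally show ?thesis .
qed

lemma mat_trace_similar:
  fixes A B :: "'a :: comm_ring_1 mat"
  assumes A: "A \<in> carrier_mat n n" and sim: "similar_mat_wit A B P Q"
  shows "mat_trace A = mat_trace B"
proof -
  note wit = similar_mat_witD2[OF A sim]
  have "mat_trace A = mat_trace (P * (B * Q))"
    using wit by (simp add: assoc_mult_mat[of _ n n _ n _ n])
  also have "\<dots> = mat_trace (B * Q * P)"
    using wit by (intro mat_trace_mult_commute[of _ n n]) auto
  also have "B * Q * P = B"
    using wit by (simp add: assoc_mult_mat[of _ n n _ n _ n])
  finally show ?thesis .
qed

lemma upper_triangular_mult: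
  fixes A B :: "'a :: semiring_0 mat"
  assumes A: "A \<in> carrier_mat n n" "upper_triangular A"
    and B: "B \<in> carrier_mat n n" "upper_triangular B"
  shows "upper_triangular (A * B)"
    and "i < n \<Longrightarrow> (A * B) $$ (i, i) = A $$ (i, i) * B $$ (i, i)"
proof -
  have idx: "(A * B) $$ (i, k) = (\<Sum>l<n. A $$ (i, l) * B $$ (l, k))" if "i < n" "k < n" for i k
    using A B that by (simp add: scalar_prod_def atLeast0LessThan)
  have zero: "A $$ (i, l) * B $$ (l, k) = 0" if "i < n" "l < n" "l < i \<or> k < l" for i k l
    using A B that by (auto simp: upper_triangular_def)
  show "upper_triangular (A * B)"
    unfolding upper_triangular_def
  proof (intro allI impI)
    fix i k assume "i < dim_row (A * B)" "k < i"
    then have i: "i < n" "k < n" "k < i" using A by auto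
    show "(A * B) $$ (i, k) = 0"
      unfolding idx[OF i(1,2)] using i by (intro sum.neutral ballI zero) auto
  qed
  assume i: "i < n"
  have "(A * B) $$ (i, i) = (\<Sum>l<n. if l = i then A $$ (i, l) * B $$ (l, i) else 0)"
    unfolding idx[OF i i] using i by (intro sum.cong) (auto intro!: zero)
  with i show "(A * B) $$ (i, i) = A $$ (i, i) * B $$ (i, i)" by simp
qed

lemma upper_triangular_pow:
  fixes B :: "'a :: comm_semiring_1 mat"
  assumes B: "B \<in> carrier_mat n n" "upper_triangular B"
  shows "upper_triangular (B ^\<^sub>m k) \<and> (\<forall>i<n. (B ^\<^sub>m k) $$ (i, i) = B $$ (i, i) ^ k)"
proof (induction k)
  case 0
  then show ?case using B by auto
next
  case (Suc k)
  have "B ^\<^sub>m k \<in> carrier_mat n n" using B by simp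
  then show ?case
    using upper_triangular_mult[of "B ^\<^sub>m k" n B] B Suc.IH by (simp add: mult.commute)
qed

text \<open>A Schur decomposition makes \<open>A\<close> similar to an upper triangular matrix with
  diagonal \<open>es\<close>. Similarity carries over to powers and preserves the trace, and taking
  a power of a triangular matrix raises each diagonal entry to that power.\<close>

lemma mat_trace_pow_eq_sum_eigenvalues:
  fixes A :: "'a :: conjugatable_ordered_field mat"
  assumes A: "A \<in> carrier_mat n n" and cp: "char_poly A = (\<Prod>a\<leftarrow>es. [:- a, 1:])"
  shows "mat_trace (A ^\<^sub>m k) = (\<Sum>a\<leftarrow>es. a ^ k)"
proof -
  obtain B P Q where dec: "schur_decomposition A es = (B, P, Q)" by (metis prod_cases3)
  note schur = schur_decomposition[OF A cp dec]
  then have sim: "similar_mat_wit A B P Q" and diag: "diag_mat B = es" by auto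
  have B: "B \<in> carrier_mat n n" "upper_triangular B"
    using similar_mat_witD2[OF A sim] schur by auto
  have "mat_trace (A ^\<^sub>m k) = mat_trace (B ^\<^sub>m k)"
    using A by (intro mat_trace_similar[OF _ similar_mat_wit_pow[OF sim]]) auto
  also have "\<dots> = (\<Sum>i<n. B $$ (i, i) ^ k)"
    using B upper_triangular_pow[OF B, of k] by (simp add: mat_trace_def)
  also have "\<dots> = (\<Sum>a\<leftarrow>diag_mat B. a ^ k)"
    using B by (simp add: diag_mat_def comp_def interv_sum_list_conv_sum_set_nat atLeast0LessThan)
  finally show ?thesis by (simp add: diag)
qed

section \<open>Nonnegative matrices and the spectral radius\<close>

lemma mat_trace_pow_nonneg:
  fixes A :: "'a :: linordered_semidom mat"
  assumes A: "A \<in> carrier_mat n n" and nonneg: "\<And>i k. i < n \<Longrightarrow> k < n \<Longrightarrow> 0 \<le> A $$ (i, k)"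
  shows "0 \<le> mat_trace (A ^\<^sub>m k)"
proof -
  have "\<forall>i<n. \<forall>l<n. 0 \<le> (A ^\<^sub>m k) $$ (i, l)"
  proof (induction k)
    case 0
    then show ?case using A by auto
  next
    case (Suc k)
    then show ?case
      using A nonneg by (auto simp: scalar_prod_def intro!: sum_nonneg mult_nonneg_nonneg)
  qed
  then show ?thesis using A by (auto simp: mat_trace_def intro!: sum_nonneg)
qed

text \<open>A value below \<open>- b\<close> would contribute a negative odd power whose modulus
  grows strictly faster than all positive contributions together, making some odd power sum
  negative.\<close>

lemma odd_power_sums_nonneg_imp_abs_le:
  fixes lam :: "'b \<Rightarrow> real"
  assumes fin: "finite I" and m: "m \<in> I"
    and upper: "\<And>i. i \<in> I \<Longrightarrow> lam i \<le> b"
    and sums: "\<And>k. odd k \<Longrightarrow> 0 \<le> (\<Sum>i\<in>I. lam i ^ k)"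
  shows "\<bar>lam m\<bar> \<le> b"
proof (rule ccontr)
  assume "\<not> \<bar>lam m\<bar> \<le> b"
  with upper[OF m] have m': "lam m < 0" "b < - lam m" by linarith+
  \<comment> \<open>The ratio of the largest possible positive contribution to the modulus of
    \<open>lam m\<close>. Since \<open>b\<close> may be negative, it is cut off at 0 so that powers
    of the bound stay nonnegative.\<close>
  define q where "q = max b 0 / (- lam m)"
  have q: "0 \<le> q" unfolding q_def using m' by (intro divide_nonneg_pos) auto
  have qm: "q * (- lam m) = max b 0" unfolding q_def using m' by simp
  have q1: "q < 1" unfolding q_def using m' by (subst pos_divide_less_eq) auto
  have "(\<lambda>k. real (card I) * q ^ k) \<longlonglongrightarrow> real (card I) * 0"
    using q q1 by (intro tendsto_intros LIMSEQ_realpow_zero)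
  then have "\<forall>\<^sub>F k in sequentially. real (card I) * q ^ k < 1"
    by (auto dest!: order_tendstoD(2)[where a = 1])
  then obtain K where K: "\<And>k. K \<le> k \<Longrightarrow> real (card I) * q ^ k < 1"
    by (auto simp: eventually_sequentially)
  define k where "k = Suc (2 * K)"
  have k: "odd k" "K \<le> k" by (auto simp: k_def)
  have "(\<Sum>i\<in>I. lam i ^ k) = lam m ^ k + (\<Sum>i\<in>I - {m}. lam i ^ k)"
    using fin m by (rule sum.remove)
  \<comment> \<open>Odd powers are monotone on the whole real line, so negative values
    \<open>lam i\<close> need no separate treatment.\<close>
  also have "(\<Sum>i\<in>I - {m}. lam i ^ k) \<le> (\<Sum>i\<in>I - {m}. max b 0 ^ k)"
    using upper k by (intro sum_mono power_mono_odd) (auto simp: le_max_iff_disj)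
  also have "\<dots> \<le> (\<Sum>i\<in>I. max b 0 ^ k)"
    using fin by (intro sum_mono2) auto
  also have "\<dots> = real (card I) * q ^ k * (- lam m) ^ k"
    unfolding qm[symmetric] power_mult_distrib by (simp add: mult.assoc)
  also have "\<dots> < 1 * (- lam m) ^ k"
    using K[OF k(2)] m' by (intro mult_strict_right_mono) auto
  also have "lam m ^ k + 1 * (- lam m) ^ k = 0"
    using k by simp
  finally show False using sums[OF k(1)] by simp
qed

text \<open>The power sums of the eigenvalues are traces of nonnegative matrices, so no eigenvalue
  drops below \<open>- lam 1\<close>. Together with \<open>top\<close>, this bounds every modulus by
  \<open>lam 1\<close>.\<close>

lemma spectral_radius_nonneg_mat:
  fixes A :: "real mat"
  assumes A: "A \<in> carrier_mat n n" and n: "1 \<le> n"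
    and nonneg: "\<And>i k. i < n \<Longrightarrow> k < n \<Longrightarrow> 0 \<le> A $$ (i, k)"
    and cp: "char_poly A = (\<Prod>i = 1..n. [:- lam i, 1:])"
    and top: "\<And>i. i \<in> {1..n} \<Longrightarrow> lam i \<le> lam 1"
  shows "spectral_radius (map_mat complex_of_real A) = lam 1"
proof -
  have cp_list: "char_poly A = (\<Prod>a\<leftarrow>map lam [1..<Suc n]. [:- a, 1:])"
    using prod.distinct_set_conv_list[of "[1..<Suc n]" "\<lambda>i. [:- lam i, 1:]"]
    by (simp add: cp comp_def atLeastLessThanSuc_atLeastAtMost del: upt_Suc)
  have "mat_trace (A ^\<^sub>m k) = (\<Sum>i = 1..n. lam i ^ k)" for k
    by (simp add: mat_trace_pow_eq_sum_eigenvalues[OF A cp_list] comp_def interv_sum_list_conv_sum_set_nat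
      atLeastLessThanSuc_atLeastAtMost del: upt_Suc)
  then have sums: "0 \<le> (\<Sum>i = 1..n. lam i ^ k)" for k
    using mat_trace_pow_nonneg[OF A nonneg, of k] by simp
  have abs_le: "\<bar>lam i\<bar> \<le> lam 1" if "i \<in> {1..n}" for i
    using that top sums by (intro odd_power_sums_nonneg_imp_abs_le[of "{1..n}"]) auto
  have A': "map_mat complex_of_real A \<in> carrier_mat n n" using A by simp
  interpret of_real_poly: map_poly_comm_ring_hom complex_of_real ..
  \<comment> \<open>The characteristic polynomial splits over the reals, so passing to complex
    numbers adds no eigenvalues.\<close>
  have "char_poly (map_mat complex_of_real A) = (\<Prod>i = 1..n. [:- complex_of_real (lam i), 1:])"
    unfolding of_real_hom.char_poly_hom[OF A] cp by (simp add: of_real_poly.hom_prod)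
  then have "spectrum (map_mat complex_of_real A) = (\<lambda>i. complex_of_real (lam i)) ` {1..n}"
    unfolding spectrum_root_char_poly[OF A'] by (auto simp: poly_prod)
  then have "spectral_radius (map_mat complex_of_real A) = Max ((\<lambda>i. \<bar>lam i\<bar>) ` {1..n})"
    by (simp add: spectral_radius_def image_image)
  also have "\<dots> = lam 1"
    using abs_le n abs_le[of 1] by (intro Max_eqI) (auto intro!: image_eqI[of _ _ 1])
  finally show ?thesis .
qed

section \<open>Signs of determinants of definite matrices\<close>

lemma real_scalar_prod_self_pos:
  fixes v :: "real vec"
  assumes "v \<in> carrier_vec n" "v \<noteq> 0\<^sub>v n"
  shows "0 < v \<bullet> v"
proof -
  obtain i where i: "i < n" "v $ i \<noteq> 0"
    using assms by (metis carrier_vecD eq_vecI index_zero_vec)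
  have "v \<bullet> v = (\<Sum>k\<in>{0..<n}. (v $ k)\<^sup>2)"
    using assms by (auto simp: scalar_prod_def power2_eq_square)
  also have "\<dots> > 0"
    using i by (intro sum_pos2[of _ i]) auto
  finally show ?thesis .
qed

lemma smult_mat_mult_vec:
  fixes M :: "'a :: comm_semiring_0 mat"
  assumes "M \<in> carrier_mat m n" "v \<in> carrier_vec n"
  shows "(k \<cdot>\<^sub>m M) *\<^sub>v v = k \<cdot>\<^sub>v (M *\<^sub>v v)"
  using assms by (intro eq_vecI) (auto simp: scalar_prod_def sum_distrib_left mult.assoc)

lemma tendsto_det:
  fixes A :: "'b \<Rightarrow> 'c :: real_normed_field mat"
  assumes "\<And>x. A x \<in> carrier_mat n n" "L \<in> carrier_mat n n"
    and "\<And>i k. i < n \<Longrightarrow> k < n \<Longrightarrow> ((\<lambda>x. A x $$ (i, k)) \<longlongrightarrow> L $$ (i, k)) F"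
  shows "((\<lambda>x. det (A x)) \<longlongrightarrow> det L) F"
  unfolding det_def'[OF assms(1)] det_def'[OF assms(2)]
proof (intro tendsto_sum tendsto_mult tendsto_const tendsto_prod assms(3))
  fix p i assume "p \<in> {p. p permutes {0..<n}}" "i \<in> {0..<n}"
  then show "i < n" "p i < n" by (auto simp: permutes_in_image)
qed

text \<open>The segment from the identity to \<open>M\<close> consists of matrices with positive
  quadratic form, hence nonsingular ones. A determinant that is 1 at one end and not positive at the
  other would vanish somewhere in between.\<close>

lemma det_pos_if_pos_def:
  fixes M :: "real mat"
  assumes M: "M \<in> carrier_mat n n"
    and pos: "\<And>v. v \<in> carrier_vec n \<Longrightarrow> v \<noteq> 0\<^sub>v n \<Longrightarrow> 0 < v \<bullet> (M *\<^sub>v v)"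
  shows "0 < det M"
proof (rule ccontr)
  assume neg: "\<not> 0 < det M"
  define A where "A t = t \<cdot>\<^sub>m M + (1 - t) \<cdot>\<^sub>m 1\<^sub>m n" for t :: real
  have A: "A t \<in> carrier_mat n n" for t using M by (simp add: A_def)
  have "((\<lambda>s. det (A s)) \<longlongrightarrow> det (A t)) (at t within {0..1})" for t
    using M by (intro tendsto_det[where n = n] A) (auto simp: A_def intro!: tendsto_intros)
  then have cont: "continuous_on {0..1} (\<lambda>t. det (A t))" by (simp add: continuous_on_def)
  have "A 0 = 1\<^sub>m n" "A 1 = M" using M by (auto simp: A_def)
  then obtain t where t: "0 \<le> t" "t \<le> 1" "det (A t) = 0"
    using IVT2'[OF _ _ _ cont, of 0] neg by auto
  then obtain v where v: "v \<in> carrier_vec n" "v \<noteq> 0\<^sub>v n" "A t *\<^sub>v v = 0\<^sub>v n"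
    using det_0_iff_vec_prod_zero[OF A] by blast
  have "A t *\<^sub>v v = t \<cdot>\<^sub>v (M *\<^sub>v v) + (1 - t) \<cdot>\<^sub>v v"
    using M v by (simp add: A_def add_mult_distrib_mat_vec[of _ n n] smult_mat_mult_vec[of _ n n])
  then have "v \<bullet> (A t *\<^sub>v v) = t * (v \<bullet> (M *\<^sub>v v)) + (1 - t) * (v \<bullet> v)"
    using M v by (simp add: scalar_prod_add_distrib[of _ n])
  moreover have "0 < t * (v \<bullet> (M *\<^sub>v v)) + (1 - t) * (v \<bullet> v)"
    \<comment> \<open>At \<open>t = 0\<close> the term of \<open>M\<close> vanishes and
      \<open>v \<bullet> v\<close> alone gives positivity; otherwise the term of \<open>M\<close> is
      positive and the other is nonnegative.\<close>
    using pos[OF v(1,2)] real_scalar_prod_self_pos[OF v(1,2)] t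
    by (cases "t = 0") (auto intro!: add_pos_nonneg)
  ultimately show False using v by simp
qed

text \<open>Adding a small positive multiple of the identity makes the form positive definite; the
  sign survives, weakly, in the limit.\<close>

lemma det_nonneg_if_pos_semidef:
  fixes M :: "real mat"
  assumes M: "M \<in> carrier_mat n n"
    and nonneg: "\<And>v. v \<in> carrier_vec n \<Longrightarrow> 0 \<le> v \<bullet> (M *\<^sub>v v)"
  shows "0 \<le> det M"
proof (rule tendsto_lowerbound)
  show "((\<lambda>e. det (M + e \<cdot>\<^sub>m 1\<^sub>m n)) \<longlongrightarrow> det M) (at_right 0)"
    using M by (intro tendsto_det[where n = n]) (auto intro!: tendsto_eq_intros)
  have "0 \<le> det (M + e \<cdot>\<^sub>m 1\<^sub>m n)" if e: "0 < e" for e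
  proof (rule less_imp_le, rule det_pos_if_pos_def)
    fix v :: "real vec" assume v: "v \<in> carrier_vec n" "v \<noteq> 0\<^sub>v n"
    have "(M + e \<cdot>\<^sub>m 1\<^sub>m n) *\<^sub>v v = M *\<^sub>v v + e \<cdot>\<^sub>v v"
      using M v by (simp add: add_mult_distrib_mat_vec[of _ n n] smult_mat_mult_vec[of _ n n])
    then have "v \<bullet> ((M + e \<cdot>\<^sub>m 1\<^sub>m n) *\<^sub>v v) = v \<bullet> (M *\<^sub>v v) + e * (v \<bullet> v)"
      using M v by (simp add: scalar_prod_add_distrib[of _ n])
    then show "0 < v \<bullet> ((M + e \<cdot>\<^sub>m 1\<^sub>m n) *\<^sub>v v)"
      using nonneg[OF v(1)] real_scalar_prod_self_pos[OF v] e by (simp add: add_nonneg_pos)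
  qed (use M in simp)
  then show "\<forall>\<^sub>F e in at_right 0. 0 \<le> det (M + e \<cdot>\<^sub>m 1\<^sub>m n)"
    by (auto intro: eventually_at_right_less[THEN eventually_mono])
qed simp

section \<open>Bordered determinants and rank-one updates at infinity\<close>

text \<open>\<open>M\<close> bordered by a last column \<open>u\<close>, a last row \<open>v\<close>
  and the corner \<open>d\<close>. The Schur complement of the corner is a rank-one update of
  \<open>M\<close>.\<close>

definition bordered_mat :: "nat \<Rightarrow> (nat \<Rightarrow> nat \<Rightarrow> 'a) \<Rightarrow> (nat \<Rightarrow> 'a) \<Rightarrow> (nat \<Rightarrow> 'a) \<Rightarrow> 'a \<Rightarrow> 'a mat" where
  "bordered_mat n M u v d = mat (Suc n) (Suc n)
     (\<lambda>(p, q). if p < n then if q < n then M p q else u p else if q < n then v q else d)"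

text \<open>Block elimination of the last row: the bordered matrix is a block upper triangular
  matrix, with the Schur complement and \<open>d\<close> on its diagonal, times a unit lower
  triangular one.\<close>

lemma det_bordered_mat:
  fixes d :: "'a :: field"
  assumes d: "d \<noteq> 0"
  shows "det (bordered_mat n M u v d) = d * det (mat n n (\<lambda>(p, q). M p q - u p * v q / d))"
proof -
  let ?S = "mat n n (\<lambda>(p, q). M p q - u p * v q / d)"
  let ?F = "four_block_mat ?S (mat n 1 (\<lambda>(p, _). u p)) (0\<^sub>m 1 n) (mat 1 1 (\<lambda>_. d))"
  let ?E = "four_block_mat (1\<^sub>m n) (0\<^sub>m n 1) (mat 1 n (\<lambda>(_, q). v q / d)) (1\<^sub>m 1)"
  have "bordered_mat n M u v d = ?F * ?E"
    by (subst mult_four_block_mat[where ?n1.0 = n and ?n2.0 = 1])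
      (auto simp: bordered_mat_def scalar_prod_def d)
  also have "det \<dots> = det ?F * det ?E"
    by (rule det_mult[of _ "Suc n"]) auto
  also have "det ?F = det ?S * d"
    by (subst det_four_block_mat_lower_left_zero[of _ n _ 1]) (auto simp: det_single)
  also have "det ?E = 1"
    by (subst det_four_block_mat_upper_right_zero[of _ n _ 1]) auto
  finally show ?thesis by simp
qed

text \<open>The last column and the last row each have at most one nonzero entry, so two Laplace
  expansions reduce the determinant to the leading minor of size \<open>n\<close>.\<close>

lemma det_bordered_mat_unit:
  fixes c :: "'a :: comm_ring_1"
  shows "det (bordered_mat (Suc n) M (\<lambda>p. if p = n then 1 else 0) (\<lambda>q. if q = n then c else 0) 0) =
    - c * det (mat n n (\<lambda>(p, q). M p q))"
proof -
  let ?B = "bordered_mat (Suc n) M (\<lambda>p. if p = n then 1 else 0) (\<lambda>q. if q = n then c else 0) 0"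
  let ?N = "mat_delete ?B n (Suc n)"
  have B: "?B \<in> carrier_mat (Suc (Suc n)) (Suc (Suc n))" by (simp add: bordered_mat_def)
  then have N: "?N \<in> carrier_mat (Suc n) (Suc n)" by auto
  have "det ?B = (\<Sum>i<Suc (Suc n). if i = n then cofactor ?B i (Suc n) else 0)"
    unfolding laplace_expansion_column[OF B lessI]
    by (intro sum.cong) (auto simp: bordered_mat_def)
  also have "\<dots> = cofactor ?B n (Suc n)" by (subst sum.delta) auto
  \<comment> \<open>The position \<open>(n, Suc n)\<close> has odd index sum; this is the source of
    the minus sign.\<close>
  also have "\<dots> = - det ?N" by (simp add: cofactor_def)
  \<comment> \<open>Deleting row \<open>n\<close> has moved the border row up to index
    \<open>n\<close>, so \<open>c\<close> now sits on the diagonal and its cofactor has sign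
    \<open>+\<close>.\<close>
  also have "det ?N = (\<Sum>q<Suc n. if q = n then c * cofactor ?N n q else 0)"
    unfolding laplace_expansion_row[OF N lessI]
    by (intro sum.cong) (auto simp: bordered_mat_def mat_delete_def)
  also have "\<dots> = c * det (mat_delete ?N n n)" by (subst sum.delta) (auto simp: cofactor_def simp flip: mult_2)
  also have "mat_delete ?N n n = mat n n (\<lambda>(p, q). M p q)"
    by (auto simp: bordered_mat_def mat_delete_def)
  finally show ?thesis by simp
qed

lemma tendsto_power_quotient_at_top:
  fixes a b :: nat
  assumes "a < b"
  shows "((\<lambda>x :: real. x ^ a / x ^ b) \<longlongrightarrow> 0) at_top"
proof (rule Lim_transform_eventually)
  show "((\<lambda>x :: real. inverse x ^ (b - a)) \<longlongrightarrow> 0) at_top"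
    using assms tendsto_power[OF tendsto_inverse_0_at_top[OF filterlim_ident], of "b - a"]
    by (simp add: zero_power)
  show "\<forall>\<^sub>F x :: real in at_top. inverse x ^ (b - a) = x ^ a / x ^ b"
    using eventually_gt_at_top[of 0]
    by eventually_elim (use assms in \<open>simp add: power_diff field_simps power_inverse\<close>)
qed

text \<open>The bordered determinant turns the rank-one update into a matrix whose entries converge
  after division of the border by \<^term>\<open>x ^ e k\<close>.\<close>

lemma det_rank_one_update_eventually_neg:
  fixes M :: "nat \<Rightarrow> nat \<Rightarrow> real" and e :: "nat \<Rightarrow> nat"
  assumes c: "0 < c" and e: "\<And>p. p < k \<Longrightarrow> e p < e k" "0 < e k"
    and minor: "0 < det (mat k k (\<lambda>(p, q). M p q))"
  shows "\<forall>\<^sub>F x in at_top.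
    det (mat (Suc k) (Suc k) (\<lambda>(p, q). M p q - c * (x ^ e p * x ^ e q))) < 0"
proof -
  \<comment> \<open>The powers of \<open>x ^ e k\<close> in border and corner cancel in the Schur
    complement, which is therefore exactly the updated matrix.\<close>
  define B where "B x = bordered_mat (Suc k) M (\<lambda>p. x ^ e p / x ^ e k)
    (\<lambda>q. c * (x ^ e q / x ^ e k)) (1 / (x ^ e k * x ^ e k))" for x :: real
  \<comment> \<open>Only the border entries at index \<open>k\<close> survive in the limit, because
    \<open>e k\<close> is the strictly largest exponent.\<close>
  define L where "L = bordered_mat (Suc k) M (\<lambda>p. if p = k then 1 else 0)
    (\<lambda>q. if q = k then c else 0) 0"
  have lim: "((\<lambda>x :: real. x ^ e p / x ^ e k) \<longlongrightarrow> 0) at_top" if "p < k" for p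
    using e(1)[OF that] by (rule tendsto_power_quotient_at_top)
  have "\<forall>\<^sub>F x :: real in at_top. 1 = x ^ e k / x ^ e k"
    using eventually_gt_at_top[of 0] by eventually_elim simp
  then have lim_k: "((\<lambda>x :: real. x ^ e k / x ^ e k) \<longlongrightarrow> 1) at_top"
    by (rule Lim_transform_eventually[OF tendsto_const])
  have corner: "((\<lambda>x :: real. 1 / (x ^ e k * x ^ e k)) \<longlongrightarrow> 0) at_top"
    using tendsto_power_quotient_at_top[of 0 "e k + e k"] e(2) by (simp add: power_add)
  have "((\<lambda>x. det (B x)) \<longlongrightarrow> det L) at_top"
  proof (rule tendsto_det)
    show "B x \<in> carrier_mat (Suc (Suc k)) (Suc (Suc k))" for x
      by (simp add: B_def bordered_mat_def)
    show "L \<in> carrier_mat (Suc (Suc k)) (Suc (Suc k))"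
      by (simp add: L_def bordered_mat_def)
    fix i l assume "i < Suc (Suc k)" "l < Suc (Suc k)"
    then have "i < k \<or> i = k \<or> i = Suc k" "l < k \<or> l = k \<or> l = Suc k" by auto
    then show "((\<lambda>x. B x $$ (i, l)) \<longlongrightarrow> L $$ (i, l)) at_top"
      unfolding B_def L_def bordered_mat_def
      using lim lim_k corner tendsto_mult_left[OF lim, of l c] tendsto_mult_left[OF lim_k, of c]
      by (elim disjE) (simp_all del: times_divide_eq_right)
  qed
  moreover have "det L < 0"
    using c minor by (simp add: L_def det_bordered_mat_unit)
  ultimately have "\<forall>\<^sub>F x in at_top. det (B x) < 0"
    by (rule order_tendstoD)
  then show ?thesis
    using eventually_gt_at_top[of 0]
  proof eventually_elim
    case (elim x)
    \<comment> \<open>For positive \<open>x\<close> the corner is a positive factor, so the sign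
      passes from \<open>B x\<close> to the updated matrix.\<close>
    have "det (B x) = 1 / (x ^ e k * x ^ e k) *
      det (mat (Suc k) (Suc k) (\<lambda>(p, q). M p q - c * (x ^ e p * x ^ e q)))"
      unfolding B_def using elim(2) by (subst det_bordered_mat) (auto simp: field_simps)
    with elim show ?case by (simp add: divide_less_0_iff mult_less_0_iff)
  qed
qed

section \<open>Rank-one sums, submatrix indexing and largest roots\<close>

text \<open>The quadratic form is a sum of squares with nonnegative weights
  \<open>\<alpha> i\<close>.\<close>

lemma det_sum_rank_one_nonneg:
  fixes w :: "'b \<Rightarrow> nat \<Rightarrow> real"
  assumes "\<And>i. i \<in> I \<Longrightarrow> 0 \<le> \<alpha> i"
  shows "0 \<le> det (mat n n (\<lambda>(p, q). \<Sum>i\<in>I. \<alpha> i * (w i p * w i q)))"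
proof (rule det_nonneg_if_pos_semidef)
  let ?M = "mat n n (\<lambda>(p, q). \<Sum>i\<in>I. \<alpha> i * (w i p * w i q))"
  fix v :: "real vec" assume v: "v \<in> carrier_vec n"
  have "v \<bullet> (?M *\<^sub>v v) = (\<Sum>p<n. \<Sum>q<n. \<Sum>i\<in>I. v $ p * (\<alpha> i * (w i p * w i q) * v $ q))"
    using v by (simp add: scalar_prod_def atLeast0LessThan sum_distrib_left sum_distrib_right)
  also have "\<dots> = (\<Sum>i\<in>I. \<Sum>p<n. \<Sum>q<n. v $ p * (\<alpha> i * (w i p * w i q) * v $ q))"
    by (subst sum.swap[of _ I], subst sum.swap[of _ I]) simp
  also have "\<dots> = (\<Sum>i\<in>I. \<alpha> i * (\<Sum>p<n. v $ p * w i p)\<^sup>2)"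
    by (simp add: power2_eq_square sum_product sum_distrib_left ac_simps)
  also have "\<dots> \<ge> 0"
    using assms by (intro sum_nonneg mult_nonneg_nonneg) auto
  finally show "0 \<le> v \<bullet> (?M *\<^sub>v v)" .
qed simp

text \<open>An increasing \<open>j\<close> lists its image in sorted order; \<open>Suc\<close>
  translates 0-based matrix positions to 1-based arguments of \<open>j\<close>. The half-open range
  serves both the full index set and the one without its last element.\<close>

lemma principal_submat_image:
  fixes j :: "nat \<Rightarrow> nat"
  assumes "strict_mono_on {1..<t} j"
  shows "principal_submat (j ` {1..<t}) A = mat (t - 1) (t - 1) (\<lambda>(p, q). A (j (Suc p)) (j (Suc q)))"
proof -
  have inj: "inj_on j {1..<t}" using assms by (rule strict_mono_on_imp_inj_on)
  have "sorted_list_of_set (j ` {1..<t}) = map j [1..<t]"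
  proof (rule sorted_list_of_set_unique[THEN iffD1], simp, intro conjI)
    show "sorted_wrt (<) (map j [1..<t])"
      using assms by (auto simp: sorted_wrt_iff_nth_less intro: strict_mono_onD)
    show "length (map j [1..<t]) = card (j ` {1..<t})"
      using inj by (simp add: card_image)
  qed simp
  moreover have "card (j ` {1..<t}) = t - 1" using inj by (simp add: card_image)
  ultimately show ?thesis by (auto simp: principal_submat_def)
qed

text \<open>Beyond some \<open>b\<close> there are no roots. The roots in \<open>{a..b}\<close> form
  a compact set, nonempty by the intermediate value theorem, so they have a maximum.\<close>

lemma ex_greatest_root_ge:
  fixes f :: "real \<Rightarrow> real"
  assumes cont: "continuous_on UNIV f" and "0 \<le> f a" and neg: "\<forall>\<^sub>F x in at_top. f x < 0"
  shows "\<exists>r. f r = 0 \<and> (\<forall>x. f x = 0 \<longrightarrow> x \<le> r) \<and> a \<le> r"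
proof -
  obtain b where b: "\<And>x. b \<le> x \<Longrightarrow> f x < 0"
    using neg by (auto simp: eventually_at_top_linorder)
  have ab: "a \<le> b" using b[of a] \<open>0 \<le> f a\<close> by force
  let ?Z = "{x \<in> {a..b}. f x = 0}"
  have "closed (f -` {0})" using cont by (intro closed_vimage) auto
  then have "compact ({a..b} \<inter> f -` {0})" by (intro compact_Int_closed) auto
  also have "{a..b} \<inter> f -` {0} = ?Z" by auto
  finally have "compact ?Z" .
  moreover have "?Z \<noteq> {}"
    using IVT2'[of f b 0 a] b[of b] ab \<open>0 \<le> f a\<close> continuous_on_subset[OF cont] by force
  ultimately obtain r where r: "r \<in> ?Z" "\<And>x. x \<in> ?Z \<Longrightarrow> x \<le> r"
    using compact_attains_sup[of ?Z] by blast
  \<comment> \<open>A root below \<open>a\<close> is below \<open>r\<close> because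
    \<open>a \<le> r\<close>; a root from \<open>a\<close> on lies in \<open>{a..b}\<close>.\<close>
  have "x \<le> r" if "f x = 0" for x
    using r that b[of x] by (cases "a \<le> x") force+
  with r show ?thesis by auto
qed

section \<open>The largest root of the Hankel determinant\<close>

theorem theorem21:
  fixes G :: "'a pair_pre_digraph" and vs :: "'a list"
    and n s :: nat and lam \<alpha> :: "nat \<Rightarrow> real" and j :: "nat \<Rightarrow> nat"
  assumes "pair_graph G"
    and "distinct vs" and "set vs = pverts G" and "length vs = n" and "1 \<le> n"
    and "char_poly (adjacency_mat G vs) = (\<Prod>i = 1..n. [:- lam i, 1:])"
    and "\<forall>i k. 1 \<le> i \<and> i \<le> k \<and> k \<le> n \<longrightarrow> lam k \<le> lam i"
    and "\<forall>i \<in> {1..n}. 0 \<le> \<alpha> i" and "0 < \<alpha> 1"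
    and "1 \<le> s" and "1 \<le> j 1" and "strict_mono_on {1..s} j"
    and "j ` {1..s} \<noteq> {1}"
    and "positive_definite (H_mat (moment n \<alpha> lam) (j ` {1..<s}))"
  shows "spectral_radius (map_mat complex_of_real (adjacency_mat G vs)) = lam 1 \<and>
    (\<exists>r. Q_fun (moment n \<alpha> lam) (\<alpha> 1) (j ` {1..s}) r = 0 \<and>
         (\<forall>x. Q_fun (moment n \<alpha> lam) (\<alpha> 1) (j ` {1..s}) x = 0 \<longrightarrow> x \<le> r) \<and>
         spectral_radius (map_mat complex_of_real (adjacency_mat G vs)) \<le> r)"
proof -
  let ?m = "moment n \<alpha> lam"
  \<comment> \<open>The Hankel index \<open>a + b - 2\<close> splits as
    \<open>(a - 1) + (b - 1)\<close>, so each entry of the matrix of \<open>r\<close> is a product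
    of two powers and that matrix has rank one.\<close>
  define e where "e p = j (Suc p) - 1" for p
  obtain k where s: "s = Suc k" using \<open>1 \<le> s\<close> by (cases s) auto
  have mono: "j a < j b" if "1 \<le> a" "a < b" "b \<le> s" for a b
    using \<open>strict_mono_on {1..s} j\<close> that by (auto simp: strict_mono_on_def)
  have j_pos: "1 \<le> j (Suc p)" if "p < s" for p
    using mono[of 1 "Suc p"] that \<open>1 \<le> j 1\<close> by (cases "p = 0") auto
  have exponent: "j (Suc p) + j (Suc q) - 2 = e p + e q" if "p < s" "q < s" for p q
    using j_pos[of p] j_pos[of q] that by (simp add: e_def)
  have e_less: "e p < e k" if "p < k" for p
    using mono[of "Suc p" "Suc k"] j_pos[of p] that by (simp add: e_def s)
  \<comment> \<open>The largest exponent is 0 only for the index set \<open>{1}\<close>, where the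
    determinant is constant in \<open>r\<close>.\<close>
  have e_pos: "0 < e k"
  proof (cases "k = 0")
    case True
    with \<open>j ` {1..s} \<noteq> {1}\<close> \<open>1 \<le> j 1\<close> show ?thesis by (simp add: s e_def)
  next
    case False
    then show ?thesis using e_less[of 0] by simp
  qed
  have "strict_mono_on {1..<s} j"
    using mono by (auto simp: strict_mono_on_def)
  then have H_minor: "H_mat ?m (j ` {1..<s}) = mat k k (\<lambda>(p, q). ?m (e p + e q))"
    unfolding H_mat_def by (subst principal_submat_image) (auto simp: hankel_def exponent s)
  have submat: "principal_submat (j ` {1..s}) A = mat s s (\<lambda>(p, q). A (j (Suc p)) (j (Suc q)))"
    for A :: "nat \<Rightarrow> nat \<Rightarrow> real"
    using principal_submat_image[of "Suc s" j A] \<open>strict_mono_on {1..s} j\<close>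
    by (simp add: atLeastLessThanSuc_atLeastAtMost)
  have Q: "Q_fun ?m (\<alpha> 1) (j ` {1..s}) x =
      det (mat s s (\<lambda>(p, q). ?m (e p + e q) - \<alpha> 1 * (x ^ e p * x ^ e q)))" for x
    unfolding Q_fun_def H_mat_def R_mat_def submat
    by (intro arg_cong[where f = det] eq_matI) (auto simp: hankel_def exponent power_add)
  have top: "lam i \<le> lam 1" if "i \<in> {1..n}" for i
    using assms(7) that by auto
  have radius: "spectral_radius (map_mat complex_of_real (adjacency_mat G vs)) = lam 1"
    using \<open>1 \<le> n\<close> \<open>length vs = n\<close> assms(6) top
    by (intro spectral_radius_nonneg_mat) (auto simp: adjacency_mat_def)
  have "((\<lambda>x. Q_fun ?m (\<alpha> 1) (j ` {1..s}) x) \<longlongrightarrow> Q_fun ?m (\<alpha> 1) (j ` {1..s}) a) (at a)" for a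
    unfolding Q by (intro tendsto_det[where n = s]) (auto intro!: tendsto_intros)
  then have cont: "continuous_on UNIV (Q_fun ?m (\<alpha> 1) (j ` {1..s}))"
    by (simp add: continuous_on_def)
  \<comment> \<open>At \<open>lam 1\<close> the subtracted matrix cancels exactly the
    \<open>i = 1\<close> term of each moment.\<close>
  have "?m (e p + e q) - \<alpha> 1 * (lam 1 ^ e p * lam 1 ^ e q) =
      (\<Sum>i = 2..n. \<alpha> i * (lam i ^ e p * lam i ^ e q))" for p q
    using \<open>1 \<le> n\<close> by (simp add: moment_def power_add sum.atLeast_Suc_atMost numeral_2_eq_2)
  then have nonneg: "0 \<le> Q_fun ?m (\<alpha> 1) (j ` {1..s}) (lam 1)"
    unfolding Q using assms(8) by (auto intro!: det_sum_rank_one_nonneg)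
  have "0 < det (mat k k (\<lambda>(p, q). ?m (e p + e q)))"
    using assms(14) unfolding H_minor positive_definite_def
    by (intro det_pos_if_pos_def[of _ k]) auto
  then have "\<forall>\<^sub>F x in at_top. Q_fun ?m (\<alpha> 1) (j ` {1..s}) x < 0"
    unfolding Q unfolding s using \<open>0 < \<alpha> 1\<close> e_less e_pos
    by (intro det_rank_one_update_eventually_neg) auto
  from ex_greatest_root_ge[OF cont nonneg this] show ?thesis
    unfolding radius by simp
qed

end
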